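(* Let $1 \leq q \leq 2 \leq p \leq \infty$ and set $1/r = 1/q - 1/p$. There is an absolute constant $M = M(p,q) > 0$ (depending only on $p$ and $q$) such that for every bounded linear operator $A : \ell_p \to \ell_q$ whose matrix $(a_{j,k})$ has non-negative entries, i.e. $a_{j,k} \geq 0$ for all $j,k$, we have \[ \left[ \sum_j \left( \sum_k |a_{j,k}|^2 \right)^{r/2} \right]^{1/r} \leq M \|A\|_{p,q} \qquad\text{and}\qquad \left[ \sum_k \left( \sum_j |a_{j,k}|^2 \right)^{r/2} \right]^{1/r} \leq M \|A\|_{p,q}. \]
   Context: For $1 \leq p < \infty$, $\ell_p$ is the complex Banach space of complex sequences $x=(x_k)$ with $\|x\|_p = \left(\sum_k |x_k|^p\right)^{1/p} < \infty$. For the index $\infty$, $\ell_\infty$ as a domain of operators stands for $c_0$, the space of complex null sequences with the norm $\|x\|_\infty = \sup_k |x_k|$. For a bounded linear operator $A : \ell_p \to \ell_q$, $\|A\|_{p,q} = \sup\{\|Ax\|_q : x \in \ell_p, \|x\|_p \leq 1\}$ is the operator norm. The matrix $(a_{j,k})$ of $A$ is taken with respect to the usual bases $(e_k)$: $a_{j,k}$ is the $j$-th coordinate of $A e_k$. The convention $1/\infty = 0$ is used; when $r=\infty$ (that is, $p=q=2$) the left-hand sides are read as $\sup_j \left( \sum_k |a_{j,k}|^2 \right)^{1/2}$ and $\sup_k \left( \sum_j |a_{j,k}|^2 \right)^{1/2}$ respectively. *)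

theory Defs
  imports "HOL-Analysis.Analysis"
begin

(* Only positive exponents a are used. *)
definition epowr :: "ennreal \<Rightarrow> real \<Rightarrow> ennreal" where
  "epowr x a = (if x = \<infinity> then \<infinity> else ennreal (enn2real x powr a))"

(* Extended-valued, so that the value is \<infinity> exactly when the sum diverges. *)
definition lp_norm :: "ennreal \<Rightarrow> (nat \<Rightarrow> complex) \<Rightarrow> ennreal" where
  "lp_norm p x =
     (if p = \<infinity> then (SUP k. ennreal (cmod (x k)))
      else epowr (\<Sum>k. epowr (ennreal (cmod (x k))) (enn2real p)) (1 / enn2real p))"

(* The index \<infinity> stands for c_0. *)
definition lp_space :: "ennreal \<Rightarrow> (nat \<Rightarrow> complex) set" where
  "lp_space p = (if p = \<infinity> then {x. x \<longlonglongrightarrow> 0} else {x. lp_norm p x < \<infinity>})"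

(* An operator is a total function on sequences of which only the restriction to lp_space p
   is relevant. *)
definition bounded_linear_operator ::
    "ennreal \<Rightarrow> ennreal \<Rightarrow> ((nat \<Rightarrow> complex) \<Rightarrow> (nat \<Rightarrow> complex)) \<Rightarrow> bool" where
  "bounded_linear_operator p q A \<longleftrightarrow>
     A ` lp_space p \<subseteq> lp_space q \<and>
     (\<forall>x\<in>lp_space p. \<forall>y\<in>lp_space p. A (\<lambda>k. x k + y k) = (\<lambda>j. A x j + A y j)) \<and>
     (\<forall>c. \<forall>x\<in>lp_space p. A (\<lambda>k. c * x k) = (\<lambda>j. c * A x j)) \<and>
     (\<exists>C::real. \<forall>x\<in>lp_space p. lp_norm q (A x) \<le> ennreal C * lp_norm p x)"

definition operator_norm ::
    "ennreal \<Rightarrow> ennreal \<Rightarrow> ((nat \<Rightarrow> complex) \<Rightarrow> (nat \<Rightarrow> complex)) \<Rightarrow> ennreal" where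
  "operator_norm p q A = (SUP x\<in>{x\<in>lp_space p. lp_norm p x \<le> 1}. lp_norm q (A x))"

definition unit_seq :: "nat \<Rightarrow> nat \<Rightarrow> complex" where
  "unit_seq k = (\<lambda>i. if i = k then 1 else 0)"

definition matrix_entry ::
    "((nat \<Rightarrow> complex) \<Rightarrow> (nat \<Rightarrow> complex)) \<Rightarrow> nat \<Rightarrow> nat \<Rightarrow> complex" where
  "matrix_entry A j k = A (unit_seq k) j"

(* The l_r(l_2) norm of the rows of a; for r = \<infinity> the supremum of their l_2 norms. *)
definition mixed_norm :: "ennreal \<Rightarrow> (nat \<Rightarrow> nat \<Rightarrow> complex) \<Rightarrow> ennreal" where
  "mixed_norm r a =
     (if r = \<infinity> then (SUP j. epowr (\<Sum>k. ennreal ((cmod (a j k))\<^sup>2)) (1 / 2))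
      else epowr (\<Sum>j. epowr (\<Sum>k. ennreal ((cmod (a j k))\<^sup>2)) (enn2real r / 2))
             (1 / enn2real r))"

end

theory Submission
  imports Defs
begin

text \<open>
  The constant \<open>M = 1\<close> works. The inequality is elementary once a finite section of the matrix
  is tested on an extremal vector.

  Let \<open>1 \<le> q < p < \<infinity>\<close>, let \<open>a\<close> be a non-negative \<open>n \<times> n\<close> section and write \<open>y = a x\<close>. Maximize
  \<open>(\<Sum>j. y j powr q) / q - (\<Sum>k. x k powr p) / p\<close> over all \<open>x \<ge> 0\<close>; since \<open>q < p\<close>, the second
  sum dominates for large \<open>x\<close>, so that a maximum exists. The first-order condition in the coordinate \<open>k\<close> is
  \<open>(\<Sum>j. a j k * y j powr (q - 1)) \<le> x k powr (p - 1)\<close>, and scaling \<open>x\<close> shows that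
  \<open>\<Sum>j. y j powr q\<close> and \<open>\<Sum>k. x k powr p\<close> have a common value \<open>S\<close>. The norm bound
  \<open>S \<le> N powr q * S powr (q / p)\<close> then gives \<open>S \<le> N powr r\<close> (lemma \<open>extremal_vector\<close>).

  The first-order condition bounds every single entry by a product of a power of \<open>x k\<close> and one of
  \<open>y j\<close>. Together with \<open>y j = (\<Sum>k. a j k * x k)\<close> it yields for the conjugate
  exponent \<open>p' = p / (p - 1) \<le> 2\<close> that the \<open>p'\<close>-norm of row \<open>j\<close>, hence also its \<open>2\<close>-norm, is at
  most \<open>y j powr (q / r)\<close>. The sum of the \<open>r\<close>-th powers over \<open>j\<close> is at most \<open>S\<close>. In the same way
  the \<open>q\<close>-norm of column \<open>k\<close>, hence its \<open>2\<close>-norm, is at most \<open>x k powr (p / r)\<close>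
  (lemma \<open>finite_section_bounds\<close>). This is an explicit form of the factorization of a positive
  operator through a diagonal multiplier.

  For \<open>p = \<infinity>\<close> the constant vector \<open>1\<close> takes the place of the extremal vector, and for \<open>p = q = 2\<close>
  one tests a row on itself and a column on a unit vector. The passage from sections to the infinite
  matrix is monotone convergence.
\<close>

section \<open>Two inequalities for real powers\<close>

text \<open>
  This replaces derivatives in the variational argument. It is Young's inequality in disguise. The
  case \<open>u = 0\<close>, \<open>s = 1\<close> is covered by the convention \<open>0 powr 0 = 0\<close>, and it is needed because
  coordinates of the extremal vector and of its image can vanish.
\<close>

lemma powr_above_tangent:
  fixes u v s :: real
  assumes "1 \<le> s" "0 \<le> u" "0 \<le> v"
  shows "u powr s + s * u powr (s - 1) * (v - u) \<le> v powr s"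
proof (cases "u = 0 \<or> v = 0")
  case False
  then have u: "0 < u" using assms by simp
  have split: "u powr s = u powr (s - 1) * u"
    using u powr_add[of u "s - 1" 1] by simp
  have "(v powr s) powr (1 / s) * (u powr s) powr (1 - 1 / s)
      \<le> 1 / s * v powr s + (1 - 1 / s) * u powr s"
    using assms False by (intro Youngs_inequality_0) auto
  moreover have "(v powr s) powr (1 / s) = v"
    using assms by (simp add: powr_powr)
  moreover have "(u powr s) powr (1 - 1 / s) = u powr (s - 1)"
    using assms by (simp add: powr_powr right_diff_distrib)
  ultimately have "v * u powr (s - 1) \<le> 1 / s * v powr s + (1 - 1 / s) * u powr s"
    by simp
  then have "s * (v * u powr (s - 1)) \<le> s * (1 / s * v powr s + (1 - 1 / s) * u powr s)"
    using assms by (intro mult_left_mono) auto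
  also have "\<dots> = v powr s + (s - 1) * u powr s"
    using assms by (simp add: field_simps)
  finally show ?thesis
    using split by (simp add: algebra_simps)
next
  case True
  have "u powr s = u powr (s - 1) * u"
    using assms powr_add[of u "s - 1" 1] by (cases "u = 0") auto
  moreover have "u powr s \<le> s * u powr s" using assms by (simp add: mult_left_le_one_le mult_le_cancel_right1)
  ultimately show ?thesis using True by (auto simp: algebra_simps)
qed

text \<open>
  The embedding of \<open>l_s\<close> into \<open>l_2\<close>. The condition \<open>q \<le> 2 \<le> p\<close> enters through it: columns use
  \<open>s = q\<close>, rows the exponent \<open>s = p / (p - 1)\<close> conjugate to \<open>p\<close>, and both are at most 2.
\<close>

lemma sum_squares_le_sum_powr:
  fixes u :: "'a \<Rightarrow> real"
  assumes "finite I" "\<And>i. i \<in> I \<Longrightarrow> 0 \<le> u i" "0 < s" "s \<le> 2"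
  shows "(\<Sum>i\<in>I. (u i)\<^sup>2) \<le> (\<Sum>i\<in>I. u i powr s) powr (2 / s)"
proof -
  define Z where "Z = (\<Sum>i\<in>I. u i powr s)"
  have Z0: "0 \<le> Z" unfolding Z_def by (intro sum_nonneg) auto
  have "(u i)\<^sup>2 \<le> u i powr s * Z powr ((2 - s) / s)" if i: "i \<in> I" for i
  proof (cases "u i = 0")
    case False
    then have ui: "0 < u i" using assms(2)[OF i] by simp
    have "u i powr s \<le> Z"
      unfolding Z_def using assms i by (intro member_le_sum) auto
    then have "(u i powr s) powr ((2 - s) / s) \<le> Z powr ((2 - s) / s)"
      using assms by (intro powr_mono2) auto
    then have "u i powr (2 - s) \<le> Z powr ((2 - s) / s)"
      using assms by (simp add: powr_powr)
    then have "u i powr s * u i powr (2 - s) \<le> u i powr s * Z powr ((2 - s) / s)"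
      by (intro mult_left_mono) auto
    moreover have "u i powr s * u i powr (2 - s) = (u i)\<^sup>2"
      using ui by (simp flip: powr_add)
    ultimately show ?thesis by simp
  qed auto
  then have "(\<Sum>i\<in>I. (u i)\<^sup>2) \<le> (\<Sum>i\<in>I. u i powr s * Z powr ((2 - s) / s))"
    by (intro sum_mono) auto
  also have "\<dots> = Z powr 1 * Z powr ((2 - s) / s)"
    using Z0 unfolding Z_def by (simp add: sum_distrib_right)
  also have "\<dots> = Z powr (2 / s)"
  proof -
    have "1 + (2 - s) / s = 2 / s" using assms by (simp add: field_simps)
    then show ?thesis by (simp only: powr_add[symmetric])
  qed
  finally show ?thesis unfolding Z_def .
qed

section \<open>The extremal vector of a finite non-negative matrix\<close>

text \<open>
  Maximizing the difference of the two powers instead of a quotient of norms removes the Lagrange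
  multiplier. With the convention \<open>0 powr 0 = 0\<close> the first-order condition says nothing about
  rows with \<open>y j = 0\<close>, not even for \<open>q = 1\<close>; such rows vanish because, at a zero of \<open>y j\<close>, moving \<open>x k\<close> by
  \<open>t\<close> would gain a multiple of \<open>t powr q\<close> and cost only a multiple of \<open>t powr p\<close>.
\<close>

lemma extremal_vector:
  fixes a :: "nat \<Rightarrow> nat \<Rightarrow> real" and N p q :: real
  assumes a: "\<And>j k. 0 \<le> a j k" and q: "1 \<le> q" and qp: "q < p" and N: "0 \<le> N"
    and bound: "\<And>x. (\<And>k. 0 \<le> x k) \<Longrightarrow>
      (\<Sum>j<n. (\<Sum>k<n. a j k * x k) powr q) \<le> N powr q * (\<Sum>k<n. x k powr p) powr (q / p)"
  obtains x y :: "nat \<Rightarrow> real"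
  where "\<And>k. 0 \<le> x k" and "\<And>j. y j = (\<Sum>k<n. a j k * x k)"
    and "\<And>k. k < n \<Longrightarrow> (\<Sum>j<n. a j k * y j powr (q - 1)) \<le> x k powr (p - 1)"
    and "\<And>j k. j < n \<Longrightarrow> k < n \<Longrightarrow> y j = 0 \<Longrightarrow> a j k = 0"
    and "(\<Sum>j<n. y j powr q) = (\<Sum>k<n. x k powr p)"
proof -
  define T where "T x = (\<Sum>j<n. (\<Sum>k<n. a j k * x k) powr q)" for x
  define S where "S x = (\<Sum>k<n. x k powr p)" for x :: "nat \<Rightarrow> real"
  define G where "G x = T x / q - S x / p" for x
  \<comment> \<open>A vector with a coordinate above \<open>R\<close> has \<open>G \<le> 0\<close>, so the maximum over the box is global.\<close>
  define R where "R = (N powr q * p / q) powr (1 / (p - q))"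
  define B where "B = (\<Pi>\<^sub>E k\<in>UNIV. if k < n then {0..R} else {0::real})"
  have p: "1 < p" using q qp by simp
  have R0: "0 \<le> R" unfolding R_def by simp
  have memB: "x \<in> B \<longleftrightarrow> (\<forall>k. 0 \<le> x k) \<and> (\<forall>k<n. x k \<le> R) \<and> (\<forall>k\<ge>n. x k = 0)" for x
  proof -
    have "x \<in> B \<longleftrightarrow> (\<forall>k. x k \<in> (if k < n then {0..R} else {0}))"
      unfolding B_def by (simp add: PiE_UNIV_domain Pi_iff)
    also have "\<dots> \<longleftrightarrow> (\<forall>k. 0 \<le> x k \<and> (k < n \<longrightarrow> x k \<le> R) \<and> (k \<ge> n \<longrightarrow> x k = 0))"
      by (rule arg_cong[where f = All], rule ext) auto
    finally show ?thesis by blast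
  qed
  have "compactin (product_topology (\<lambda>_. euclidean) UNIV) B"
    unfolding B_def by (subst compactin_PiE) auto
  then have "compact B"
    by (simp add: euclidean_product_topology)
  moreover have "(\<lambda>_. 0) \<in> B" using R0 by (simp add: memB)
  moreover have "continuous_on B G"
  proof -
    have coord: "continuous_on B (\<lambda>x. x k)" for k
      by (rule continuous_on_subset[OF continuous_on_product_coordinates subset_UNIV])
    have "continuous_on B (\<lambda>x. x k powr p)" for k
      by (rule continuous_on_powr'[OF coord continuous_on_const]) (use p memB in auto)
    moreover have "continuous_on B (\<lambda>x. (\<Sum>k<n. a j k * x k) powr q)" for j
    proof (rule continuous_on_powr'[OF _ continuous_on_const])
      show "continuous_on B (\<lambda>x. \<Sum>k<n. a j k * x k)"
        by (intro continuous_on_sum continuous_on_mult continuous_on_const coord)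
      show "\<forall>x\<in>B. 0 \<le> (\<Sum>k<n. a j k * x k) \<and> ((\<Sum>k<n. a j k * x k) = 0 \<longrightarrow> 0 < q)"
        using q memB a by (auto intro!: sum_nonneg)
    qed
    ultimately show ?thesis
      unfolding G_def T_def S_def
      by (intro continuous_on_diff continuous_on_divide continuous_on_sum continuous_on_const)
        (use p q in auto)
  qed
  ultimately obtain x where xB: "x \<in> B" and xmax: "\<And>z. z \<in> B \<Longrightarrow> G z \<le> G x"
    using continuous_attains_sup[of B G] by blast
  have x0: "0 \<le> x k" for k using xB memB by blast
  have G0: "G (\<lambda>_. 0) = 0" unfolding G_def T_def S_def by simp
  have S0: "0 \<le> S z" for z unfolding S_def by (intro sum_nonneg) auto
  have max: "G z \<le> G x" if z: "\<And>k. 0 \<le> z k" for z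
  proof (cases "\<forall>k<n. z k \<le> R")
    case True
    define z' where "z' k = (if k < n then z k else 0)" for k
    have "G z' = G z" unfolding G_def T_def S_def z'_def by simp
    moreover have "z' \<in> B" using z True R0 by (auto simp: memB z'_def)
    ultimately show ?thesis using xmax by metis
  next
    case False
    then obtain k where k: "k < n" "R < z k" by (auto simp: not_le)
    have Spos: "0 < S z"
    proof -
      have "0 < z k powr p" using k R0 by simp
      also have "\<dots> \<le> S z" unfolding S_def using k by (intro member_le_sum) auto
      finally show ?thesis .
    qed
    have "R powr p \<le> z k powr p" using k R0 p by (intro powr_mono2) auto
    also have "\<dots> \<le> S z" unfolding S_def using k by (intro member_le_sum) auto
    finally have "(R powr p) powr ((p - q) / p) \<le> S z powr ((p - q) / p)"
      using p qp by (intro powr_mono2) auto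
    then have "N powr q * p / q \<le> S z powr ((p - q) / p)"
      unfolding R_def using p q qp by (simp add: powr_powr)
    then have "S z powr (q / p) * (N powr q * p / q) \<le> S z powr (q / p) * S z powr ((p - q) / p)"
      by (intro mult_left_mono) auto
    also have "\<dots> = S z"
      using Spos p by (simp flip: powr_add add_divide_distrib)
    finally have "S z powr (q / p) * N powr q / q \<le> S z / p"
      using p q by (simp add: field_simps)
    moreover have "T z / q \<le> N powr q * S z powr (q / p) / q"
      unfolding T_def S_def using bound[OF z] q by (intro divide_right_mono) auto
    ultimately have "G z \<le> 0" unfolding G_def by (simp add: mult.commute)
    also have "0 \<le> G x" using xmax[OF \<open>(\<lambda>_. 0) \<in> B\<close>] G0 by simp
    finally show ?thesis .
  qed
  define y where "y j = (\<Sum>k<n. a j k * x k)" for j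
  have y0: "0 \<le> y j" for j
    unfolding y_def by (intro sum_nonneg mult_nonneg_nonneg a x0)
  have Tx: "T x = (\<Sum>j<n. y j powr q)" unfolding T_def y_def ..
  \<comment> \<open>Maximality tested against moving one coordinate upwards.\<close>
  have perturb: "(\<Sum>j<n. (y j + a j k * t) powr q - y j powr q) / q
      \<le> ((x k + t) powr p - x k powr p) / p" if k: "k < n" and t: "0 \<le> t" for k t
  proof -
    define z where "z = x(k := x k + t)"
    have z_alt: "z i = x i + (if i = k then t else 0)" for i unfolding z_def by simp
    have "(\<Sum>i<n. a j i * z i) = y j + a j k * t" for j
      unfolding y_def z_alt using k
      by (simp add: distrib_left sum.distrib if_distrib[of "\<lambda>c. _ * c"] sum.delta cong: if_cong)
    then have "T z - T x = (\<Sum>j<n. (y j + a j k * t) powr q - y j powr q)"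
      unfolding Tx by (simp add: T_def sum_subtractf)
    moreover have "S z - S x = (x k + t) powr p - x k powr p"
    proof -
      have "S z - S x = (\<Sum>i<n. if i = k then (x k + t) powr p - x k powr p else 0)"
        unfolding S_def sum_subtractf[symmetric] z_def by (intro sum.cong) auto
      then show ?thesis using k by simp
    qed
    moreover have "G z \<le> G x" by (rule max) (use x0 t in \<open>auto simp: z_def\<close>)
    ultimately show ?thesis
      unfolding G_def by (simp add: diff_divide_distrib flip: \<open>T z - T x = _\<close> \<open>S z - S x = _\<close>)
  qed
  have crit: "(\<Sum>j<n. a j k * y j powr (q - 1)) \<le> x k powr (p - 1)" if k: "k < n" for k
  proof -
    have "(\<Sum>j<n. a j k * y j powr (q - 1)) \<le> (x k + t) powr (p - 1)" if t: "0 < t" for t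
    proof -
      have "q * (a j k * t) * y j powr (q - 1) \<le> (y j + a j k * t) powr q - y j powr q" for j
        using powr_above_tangent[OF q y0[of j], of "y j + a j k * t"] a[of j k] y0[of j] t
        by (simp add: algebra_simps)
      then have "(\<Sum>j<n. q * (a j k * t) * y j powr (q - 1)) / q
          \<le> (\<Sum>j<n. (y j + a j k * t) powr q - y j powr q) / q"
        using q by (intro divide_right_mono sum_mono) auto
      also have "\<dots> \<le> ((x k + t) powr p - x k powr p) / p"
        using perturb[OF k] t by simp
      also have "\<dots> \<le> (x k + t) powr (p - 1) * t"
        using powr_above_tangent[of p "x k + t" "x k"] x0[of k] t p by (simp add: field_simps)
      finally have "(\<Sum>j<n. q * (a j k * t) * y j powr (q - 1)) / q \<le> (x k + t) powr (p - 1) * t" .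
      moreover have "(\<Sum>j<n. q * (a j k * t) * y j powr (q - 1)) / q
          = (\<Sum>j<n. a j k * y j powr (q - 1)) * t"
        using q by (simp add: sum_divide_distrib sum_distrib_left ac_simps)
      ultimately show ?thesis using t by simp
    qed
    then have "eventually (\<lambda>t. (\<Sum>j<n. a j k * y j powr (q - 1)) \<le> (x k + t) powr (p - 1)) (at_right 0)"
      by (auto simp: eventually_at_right_field intro: exI[of _ 1])
    moreover have "((\<lambda>t. (x k + t) powr (p - 1)) \<longlongrightarrow> (x k + 0) powr (p - 1)) (at_right 0)"
      by (intro tendsto_powr' tendsto_intros)
        (use p x0 in \<open>auto simp: eventually_at_right_field add_nonneg_nonneg intro!: exI[of _ 1]\<close>)
    ultimately show ?thesis
      using tendsto_lowerbound[of _ _ "at_right (0::real)"] by fastforce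
  qed
  have zero: "a j k = 0" if j: "j < n" and k: "k < n" and yj: "y j = 0" for j k
  proof (rule ccontr)
    assume "a j k \<noteq> 0"
    then have ap: "0 < a j k" using a[of j k] by simp
    have "a j k * x k = 0"
      using yj k unfolding y_def by (subst (asm) sum_nonneg_eq_0_iff) (auto simp: a x0)
    then have xk: "x k = 0" using ap by simp
    have "a j k powr q / q \<le> t powr (p - q) / p" if t: "0 < t" for t
    proof -
      have "(a j k * t) powr q = (y j + a j k * t) powr q - y j powr q"
        using yj by simp
      also have "\<dots> \<le> (\<Sum>j<n. (y j + a j k * t) powr q - y j powr q)"
        using j q y0 a t by (intro member_le_sum) (auto intro!: powr_mono2)
      finally have "(a j k * t) powr q / q \<le> t powr p / p"
        using perturb[OF k, of t] t q xk by (simp add: divide_right_mono order_trans[rotated])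
      moreover have "t powr p = t powr (p - q) * t powr q"
        using t by (simp flip: powr_add)
      ultimately have "(a j k powr q / q) * t powr q \<le> (t powr (p - q) / p) * t powr q"
        using ap t by (simp add: powr_mult)
      then show ?thesis by (rule mult_right_le_imp_le) (use t in simp)
    qed
    then have "eventually (\<lambda>t. a j k powr q / q \<le> t powr (p - q) / p) (at_right 0)"
      by (auto simp: eventually_at_right_field intro: exI[of _ 1])
    moreover have "((\<lambda>t. t powr (p - q) / p) \<longlongrightarrow> 0 powr (p - q) / p) (at_right 0)"
      by (intro tendsto_powr' tendsto_intros)
        (use p qp in \<open>auto simp: eventually_at_right_field intro!: exI[of _ 1]\<close>)
    ultimately have "a j k powr q / q \<le> 0 powr (p - q) / p"
      using tendsto_lowerbound[of _ _ "at_right (0::real)"] by fastforce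
    moreover have "0 < a j k powr q / q" using ap q by simp
    ultimately show False by simp
  qed
  \<comment> \<open>Multiply the first-order condition by \<open>x k\<close> and sum over \<open>k\<close>.\<close>
  have "T x \<le> S x"
  proof -
    have "T x = (\<Sum>j<n. \<Sum>k<n. x k * (a j k * y j powr (q - 1)))"
      unfolding Tx
    proof (rule sum.cong[OF refl])
      fix j
      have "y j powr q = y j * y j powr (q - 1)"
        using powr_add[of "y j" 1 "q - 1"] y0[of j] by (cases "y j = 0") auto
      also have "\<dots> = (\<Sum>k<n. x k * (a j k * y j powr (q - 1)))"
        by (subst (1) y_def) (simp add: sum_distrib_left ac_simps)
      finally show "y j powr q = (\<Sum>k<n. x k * (a j k * y j powr (q - 1)))" .
    qed
    also have "\<dots> = (\<Sum>k<n. x k * (\<Sum>j<n. a j k * y j powr (q - 1)))"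
      by (subst sum.swap) (simp add: sum_distrib_left)
    also have "\<dots> \<le> (\<Sum>k<n. x k * x k powr (p - 1))"
      using crit x0 by (intro sum_mono mult_left_mono) auto
    also have "\<dots> = S x"
      unfolding S_def
    proof (rule sum.cong[OF refl])
      fix k show "x k * x k powr (p - 1) = x k powr p"
        using powr_add[of "x k" 1 "p - 1"] x0[of k] by (cases "x k = 0") auto
    qed
    finally show ?thesis .
  qed
  \<comment> \<open>The reverse comes from shrinking \<open>x\<close> to \<open>c x\<close> with \<open>c\<close> tending to 1 from below.\<close>
  moreover have "S x \<le> T x"
  proof -
    have "S x * c powr (p - 1) \<le> T x" if c: "0 < c" "c < 1" for c
    proof -
      have "G (\<lambda>k. c * x k) \<le> G x" using c x0 by (intro max) auto
      moreover have "T (\<lambda>k. c * x k) = c powr q * T x"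
      proof -
        have "(\<Sum>k<n. a j k * (c * x k)) = c * y j" for j
          unfolding y_def by (simp add: sum_distrib_left ac_simps)
        then show ?thesis unfolding Tx using c y0
          by (simp add: T_def powr_mult sum_distrib_left)
      qed
      moreover have "S (\<lambda>k. c * x k) = c powr p * S x"
        unfolding S_def using c x0 by (simp add: powr_mult sum_distrib_left)
      ultimately have le: "S x * ((1 - c powr p) / p) \<le> T x * ((1 - c powr q) / q)"
        unfolding G_def by (simp add: algebra_simps diff_divide_distrib)
      have "c powr (p - 1) * (1 - c) \<le> (1 - c powr p) / p"
        using powr_above_tangent[of p c 1] p c by (simp add: field_simps)
      then have "S x * (c powr (p - 1) * (1 - c)) \<le> S x * ((1 - c powr p) / p)"
        by (intro mult_left_mono S0)
      also note le
      also have "T x * ((1 - c powr q) / q) \<le> T x * (1 - c)"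
      proof (rule mult_left_mono)
        show "(1 - c powr q) / q \<le> 1 - c"
          using powr_above_tangent[of q 1 c] q c by (simp add: field_simps)
        show "0 \<le> T x" unfolding Tx by (intro sum_nonneg) auto
      qed
      finally show ?thesis using c by (simp add: mult.assoc[symmetric])
    qed
    then have "eventually (\<lambda>c. S x * c powr (p - 1) \<le> T x) (at_left 1)"
      by (auto simp: eventually_at_left_field intro: exI[of _ 0])
    moreover have "((\<lambda>c. S x * c powr (p - 1)) \<longlongrightarrow> S x * 1 powr (p - 1)) (at_left 1)"
      by (intro tendsto_intros) auto
    ultimately show ?thesis
      using tendsto_upperbound[of _ _ "at_left (1::real)"] by fastforce
  qed
  ultimately have TS: "(\<Sum>j<n. y j powr q) = (\<Sum>k<n. x k powr p)"
    unfolding Tx S_def by simp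
  show thesis
    by (rule that[of x y]) (use x0 y_def crit zero TS in auto)
qed

section \<open>Mixed norms of finite sections\<close>

text \<open>
  In a row, \<open>a j k powr s = a j k * a j k powr (s - 1)\<close>, where the second factor is estimated by the
  first-order condition so that \<open>\<Sum>k. a j k * x k = y j\<close> appears. In a column the roles are
  exchanged: the second factor of \<open>a j k powr q\<close> is estimated by \<open>a j k * x k \<le> y j\<close>, and the
  first-order condition evaluates the remaining sum.
\<close>

lemma finite_section_bounds:
  fixes a :: "nat \<Rightarrow> nat \<Rightarrow> real" and N p q r :: real
  assumes a: "\<And>j k. 0 \<le> a j k" and q: "1 \<le> q" "q \<le> 2" and p: "2 \<le> p" and qp: "q < p"
    and N: "0 \<le> N" and r: "r = p * q / (p - q)"
    and bound: "\<And>x. (\<And>k. 0 \<le> x k) \<Longrightarrow>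
      (\<Sum>j<n. (\<Sum>k<n. a j k * x k) powr q) \<le> N powr q * (\<Sum>k<n. x k powr p) powr (q / p)"
  shows "(\<Sum>j<n. (\<Sum>k<n. (a j k)\<^sup>2) powr (r / 2)) \<le> N powr r"
    and "(\<Sum>k<n. (\<Sum>j<n. (a j k)\<^sup>2) powr (r / 2)) \<le> N powr r"
proof -
  obtain x y where x0: "\<And>k. 0 \<le> x k" and y: "\<And>j. y j = (\<Sum>k<n. a j k * x k)"
    and crit: "\<And>k. k < n \<Longrightarrow> (\<Sum>j<n. a j k * y j powr (q - 1)) \<le> x k powr (p - 1)"
    and zero: "\<And>j k. j < n \<Longrightarrow> k < n \<Longrightarrow> y j = 0 \<Longrightarrow> a j k = 0"
    and TS: "(\<Sum>j<n. y j powr q) = (\<Sum>k<n. x k powr p)"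
  proof (rule extremal_vector[where a = a and n = n, OF a q(1) qp N], goal_cases)
    case (1 x)
    show ?case by (rule bound[OF 1(2)])
  next
    case (2 x y)
    show ?case by (rule that[OF 2(2-6)])
  qed
  define S where "S = (\<Sum>k<n. x k powr p)"
  have y0: "0 \<le> y j" for j
    unfolding y by (intro sum_nonneg mult_nonneg_nonneg a x0)
  have r0: "0 < r" unfolding r using p q qp by simp
  have S_le: "S \<le> N powr r"
  proof (cases "S = 0")
    case False
    moreover have "0 \<le> S" unfolding S_def by (intro sum_nonneg) auto
    ultimately have S0: "0 < S" by simp
    have "S powr ((p - q) / p) * S powr (q / p) = S"
      using S0 p by (simp flip: powr_add add_divide_distrib)
    moreover have "S \<le> N powr q * S powr (q / p)"
      using bound[where x = x, OF x0] unfolding y[symmetric] TS S_def[symmetric] .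
    ultimately have "S powr ((p - q) / p) * S powr (q / p) \<le> N powr q * S powr (q / p)"
      by (simp only:)
    then have "S powr ((p - q) / p) \<le> N powr q"
      by (rule mult_right_le_imp_le) (use S0 in simp)
    then have "(S powr ((p - q) / p)) powr (p / (p - q)) \<le> (N powr q) powr (p / (p - q))"
      using p qp by (intro powr_mono2) auto
    moreover have "(S powr ((p - q) / p)) powr (p / (p - q)) = S"
      using p qp S0 by (simp add: powr_powr)
    moreover have "(N powr q) powr (p / (p - q)) = N powr r"
      unfolding r by (simp add: powr_powr mult.commute)
    ultimately show ?thesis by simp
  qed simp
  have entry_le: "a j k * y j powr (q - 1) \<le> x k powr (p - 1)" if "j < n" "k < n" for j k
  proof -
    have "a j k * y j powr (q - 1) \<le> (\<Sum>j<n. a j k * y j powr (q - 1))"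
      using that a by (intro member_le_sum) auto
    then show ?thesis using crit[OF that(2)] by simp
  qed
  have entry_le': "a j k * x k \<le> y j" if "k < n" for j k
    unfolding y using that a x0 by (intro member_le_sum) auto
  have row: "(\<Sum>k<n. (a j k)\<^sup>2) powr (r / 2) \<le> y j powr q" if j: "j < n" for j
  proof (cases "y j = 0")
    case True
    then show ?thesis using zero[OF j] by simp
  next
    case False
    then have yj: "0 < y j" using y0[of j] by simp
    \<comment> \<open>The exponent conjugate to \<open>p\<close>.\<close>
    define s where "s = p / (p - 1)"
    have s: "0 < s" "s \<le> 2" "s - 1 = 1 / (p - 1)"
      unfolding s_def using p by (auto simp: field_simps)
    define c where "c = y j powr (- ((q - 1) / (p - 1)))"
    have "a j k powr s \<le> (a j k * x k) * c" if k: "k < n" for k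
    proof (cases "a j k = 0")
      case False
      then have ap: "0 < a j k" using a[of j k] by simp
      have "(a j k * y j powr (q - 1)) powr (1 / (p - 1)) \<le> (x k powr (p - 1)) powr (1 / (p - 1))"
        using entry_le[OF j k] a p by (intro powr_mono2) auto
      then have "a j k powr (s - 1) * y j powr ((q - 1) / (p - 1)) \<le> x k"
        using p x0[of k] ap s(3) by (simp add: powr_mult powr_powr)
      then have "(a j k powr (s - 1) * y j powr ((q - 1) / (p - 1))) * c \<le> x k * c"
        unfolding c_def by (intro mult_right_mono) auto
      moreover have "y j powr ((q - 1) / (p - 1)) * c = 1"
        unfolding c_def using yj by (simp flip: powr_add)
      ultimately have "a j k powr (s - 1) \<le> x k * c"
        by (simp add: mult.assoc)
      then have "a j k * a j k powr (s - 1) \<le> a j k * (x k * c)"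
        using ap by (intro mult_left_mono) auto
      moreover have "a j k * a j k powr (s - 1) = a j k powr s"
        using powr_add[of "a j k" 1 "s - 1"] ap by simp
      ultimately show ?thesis by (simp add: mult.assoc)
    qed (use x0 in auto)
    then have "(\<Sum>k<n. a j k powr s) \<le> y j * c"
      unfolding y sum_distrib_right by (intro sum_mono) auto
    also have "y j * c = y j powr ((p - q) / (p - 1))"
    proof -
      have "1 + - ((q - 1) / (p - 1)) = (p - q) / (p - 1)"
        using p by (simp add: field_simps)
      then show ?thesis
        unfolding c_def using yj powr_add[of "y j" 1 "- ((q - 1) / (p - 1))"] by simp
    qed
    finally have le: "(\<Sum>k<n. a j k powr s) \<le> y j powr ((p - q) / (p - 1))" .
    have "(\<Sum>k<n. (a j k)\<^sup>2) \<le> (\<Sum>k<n. a j k powr s) powr (2 / s)"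
      using a s by (intro sum_squares_le_sum_powr) auto
    also have "\<dots> \<le> (y j powr ((p - q) / (p - 1))) powr (2 / s)"
      using le s by (intro powr_mono2 sum_nonneg) auto
    finally have "(\<Sum>k<n. (a j k)\<^sup>2) powr (r / 2)
        \<le> ((y j powr ((p - q) / (p - 1))) powr (2 / s)) powr (r / 2)"
      using r0 by (intro powr_mono2 sum_nonneg) auto
    also have "\<dots> = y j powr ((p - q) / (p - 1) * (2 / s) * (r / 2))"
      by (simp add: powr_powr mult.assoc)
    also have "(p - q) / (p - 1) * (2 / s) * (r / 2) = q"
    proof -
      have "d / e * (2 / (p / e)) * (p * q / d / 2) = q" if "d \<noteq> 0" "e \<noteq> 0" for d e
        using that p by simp
      moreover have "p - q \<noteq> 0" "p - 1 \<noteq> 0" using p qp by auto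
      ultimately show ?thesis unfolding s_def r by blast
    qed
    finally show ?thesis .
  qed
  have col: "(\<Sum>j<n. (a j k)\<^sup>2) powr (r / 2) \<le> x k powr p" if k: "k < n" for k
  proof (cases "x k = 0")
    case True
    have "a j k = 0" if j: "j < n" for j
    proof (cases "y j = 0")
      case False
      then have "0 < y j powr (q - 1)" by simp
      moreover have "a j k * y j powr (q - 1) \<le> 0"
        using entry_le[OF j k] True by simp
      ultimately show ?thesis using a[of j k] by (simp add: mult_le_0_iff)
    qed (use zero j k in auto)
    then show ?thesis by simp
  next
    case False
    then have xk: "0 < x k" using x0[of k] by simp
    define c where "c = x k powr (- (q - 1))"
    have "a j k powr q \<le> (a j k * y j powr (q - 1)) * c" if j: "j < n" for j
    proof (cases "a j k = 0")
      case False
      then have ap: "0 < a j k" using a[of j k] by simp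
      have "(a j k * x k) powr (q - 1) \<le> y j powr (q - 1)"
        using entry_le'[OF k] q ap x0 by (intro powr_mono2) auto
      then have "a j k powr (q - 1) * x k powr (q - 1) \<le> y j powr (q - 1)"
        using ap x0 by (simp add: powr_mult)
      then have "a j k powr (q - 1) * x k powr (q - 1) * c \<le> y j powr (q - 1) * c"
        unfolding c_def by (intro mult_right_mono) auto
      moreover have "x k powr (q - 1) * c = 1"
        unfolding c_def using xk by (simp flip: powr_add)
      ultimately have "a j k powr (q - 1) \<le> y j powr (q - 1) * c"
        by (simp add: mult.assoc)
      then have "a j k * a j k powr (q - 1) \<le> a j k * (y j powr (q - 1) * c)"
        using ap by (intro mult_left_mono) auto
      moreover have "a j k * a j k powr (q - 1) = a j k powr q"
        using powr_add[of "a j k" 1 "q - 1"] ap by simp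
      ultimately show ?thesis by (simp add: mult.assoc)
    qed auto
    then have "(\<Sum>j<n. a j k powr q) \<le> (\<Sum>j<n. a j k * y j powr (q - 1)) * c"
      unfolding sum_distrib_right by (intro sum_mono) auto
    also have "\<dots> \<le> x k powr (p - 1) * c"
      unfolding c_def using crit[OF k] by (intro mult_right_mono) auto
    also have "\<dots> = x k powr (p - q)"
      unfolding c_def by (simp flip: powr_add)
    finally have le: "(\<Sum>j<n. a j k powr q) \<le> x k powr (p - q)" .
    have "(\<Sum>j<n. (a j k)\<^sup>2) \<le> (\<Sum>j<n. a j k powr q) powr (2 / q)"
      using a q by (intro sum_squares_le_sum_powr) auto
    also have "\<dots> \<le> (x k powr (p - q)) powr (2 / q)"
      using le q by (intro powr_mono2 sum_nonneg) auto
    finally have "(\<Sum>j<n. (a j k)\<^sup>2) powr (r / 2) \<le> ((x k powr (p - q)) powr (2 / q)) powr (r / 2)"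
      using r0 by (intro powr_mono2 sum_nonneg) auto
    also have "\<dots> = x k powr ((p - q) * (2 / q) * (r / 2))"
      by (simp add: powr_powr mult.assoc)
    also have "(p - q) * (2 / q) * (r / 2) = p"
    proof -
      have "d * (2 / q) * (p * q / d / 2) = p" if "d \<noteq> 0" for d
        using that q by simp
      moreover have "p - q \<noteq> 0" using qp by simp
      ultimately show ?thesis unfolding r by blast
    qed
    finally show ?thesis .
  qed
  have "(\<Sum>j<n. (\<Sum>k<n. (a j k)\<^sup>2) powr (r / 2)) \<le> (\<Sum>j<n. y j powr q)"
    using row by (intro sum_mono) auto
  then show "(\<Sum>j<n. (\<Sum>k<n. (a j k)\<^sup>2) powr (r / 2)) \<le> N powr r"
    using S_le TS unfolding S_def by simp
  have "(\<Sum>k<n. (\<Sum>j<n. (a j k)\<^sup>2) powr (r / 2)) \<le> (\<Sum>k<n. x k powr p)"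
    using col by (intro sum_mono) auto
  then show "(\<Sum>k<n. (\<Sum>j<n. (a j k)\<^sup>2) powr (r / 2)) \<le> N powr r"
    using S_le unfolding S_def by simp
qed

text \<open>
  The limiting case \<open>p = \<infinity>\<close>, where \<open>r = q\<close>. For rows the \<open>1\<close>-norm dominates the \<open>2\<close>-norm; for
  columns the \<open>q\<close>-norm does, after which the order of summation is exchanged and the sum of
  \<open>q\<close>-th powers is at most the \<open>q\<close>-th power of the sum.
\<close>

lemma finite_section_bounds_c0:
  fixes a :: "nat \<Rightarrow> nat \<Rightarrow> real" and N q :: real
  assumes a: "\<And>j k. 0 \<le> a j k" and q: "1 \<le> q" "q \<le> 2"
    and bound: "(\<Sum>j<n. (\<Sum>k<n. a j k) powr q) \<le> N powr q"
  shows "(\<Sum>j<n. (\<Sum>k<n. (a j k)\<^sup>2) powr (q / 2)) \<le> N powr q"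
    and "(\<Sum>k<n. (\<Sum>j<n. (a j k)\<^sup>2) powr (q / 2)) \<le> N powr q"
proof -
  have "(\<Sum>k<n. (a j k)\<^sup>2) powr (q / 2) \<le> (\<Sum>k<n. a j k) powr q" for j
  proof -
    have "(\<Sum>k<n. (a j k)\<^sup>2) \<le> (\<Sum>k<n. a j k powr 1) powr (2 / 1)"
      using a by (intro sum_squares_le_sum_powr) auto
    then have "(\<Sum>k<n. (a j k)\<^sup>2) powr (q / 2) \<le> ((\<Sum>k<n. a j k powr 1) powr (2 / 1)) powr (q / 2)"
      using q by (intro powr_mono2 sum_nonneg) auto
    moreover have "((\<Sum>k<n. a j k powr 1) powr (2 / 1)) powr (q / 2) = (\<Sum>k<n. a j k) powr q"
      using a by (subst powr_powr) simp
    ultimately show ?thesis by simp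
  qed
  then have "(\<Sum>j<n. (\<Sum>k<n. (a j k)\<^sup>2) powr (q / 2)) \<le> (\<Sum>j<n. (\<Sum>k<n. a j k) powr q)"
    by (intro sum_mono) auto
  then show "(\<Sum>j<n. (\<Sum>k<n. (a j k)\<^sup>2) powr (q / 2)) \<le> N powr q"
    using bound by simp
  have "(\<Sum>j<n. (a j k)\<^sup>2) powr (q / 2) \<le> (\<Sum>j<n. a j k powr q)" for k
  proof -
    have "(\<Sum>j<n. (a j k)\<^sup>2) \<le> (\<Sum>j<n. a j k powr q) powr (2 / q)"
      using a q by (intro sum_squares_le_sum_powr) auto
    then have "(\<Sum>j<n. (a j k)\<^sup>2) powr (q / 2) \<le> ((\<Sum>j<n. a j k powr q) powr (2 / q)) powr (q / 2)"
      using q by (intro powr_mono2 sum_nonneg) auto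
    then show ?thesis using q by (simp add: powr_powr sum_nonneg)
  qed
  then have "(\<Sum>k<n. (\<Sum>j<n. (a j k)\<^sup>2) powr (q / 2)) \<le> (\<Sum>k<n. \<Sum>j<n. a j k powr q)"
    by (intro sum_mono) auto
  also have "\<dots> = (\<Sum>j<n. \<Sum>k<n. a j k powr q)" by (rule sum.swap)
  also have "\<dots> \<le> (\<Sum>j<n. (\<Sum>k<n. a j k) powr q)"
  proof (rule sum_mono)
    fix j
    let ?U = "\<Sum>k<n. a j k"
    have mult_powr: "u * u powr (q - 1) = u powr q" if "0 \<le> u" for u :: real
      using powr_add[of u 1 "q - 1"] that by (cases "u = 0") auto
    have "(\<Sum>k<n. a j k powr q) = (\<Sum>k<n. a j k * a j k powr (q - 1))"
      using a by (simp add: mult_powr)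
    also have "\<dots> \<le> (\<Sum>k<n. a j k * ?U powr (q - 1))"
      using a q by (intro sum_mono mult_left_mono powr_mono2 member_le_sum) auto
    also have "\<dots> = ?U powr q"
      using a by (simp add: mult_powr sum_nonneg flip: sum_distrib_right)
    finally show "(\<Sum>k<n. a j k powr q) \<le> ?U powr q" .
  qed
  finally show "(\<Sum>k<n. (\<Sum>j<n. (a j k)\<^sup>2) powr (q / 2)) \<le> N powr q"
    using bound by simp
qed

text \<open>
  The limiting case \<open>p = q = 2\<close>, where \<open>r = \<infinity>\<close> and the functional of the general case
  need not be coercive.
\<close>

lemma finite_section_bounds_l2:
  fixes a :: "nat \<Rightarrow> nat \<Rightarrow> real" and N :: real
  assumes a: "\<And>j k. 0 \<le> a j k"
    and bound: "\<And>x. (\<And>k. 0 \<le> x k) \<Longrightarrow>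
      (\<Sum>j<n. (\<Sum>k<n. a j k * x k)\<^sup>2) \<le> N\<^sup>2 * (\<Sum>k<n. (x k)\<^sup>2)"
    and m: "m < n"
  shows "(\<Sum>k<n. (a m k)\<^sup>2) \<le> N\<^sup>2" and "(\<Sum>j<n. (a j m)\<^sup>2) \<le> N\<^sup>2"
proof -
  define Z where "Z = (\<Sum>k<n. (a m k)\<^sup>2)"
  have Z0: "0 \<le> Z" unfolding Z_def by (intro sum_nonneg) auto
  \<comment> \<open>The row is tested on itself, the column below on a unit vector.\<close>
  have "Z\<^sup>2 = (\<Sum>k<n. a m k * a m k)\<^sup>2" unfolding Z_def by (simp add: power2_eq_square)
  also have "\<dots> \<le> (\<Sum>j<n. (\<Sum>k<n. a j k * a m k)\<^sup>2)"
    using m by (intro member_le_sum) auto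
  also have "\<dots> \<le> N\<^sup>2 * Z" unfolding Z_def by (rule bound[OF a])
  finally have "Z * Z \<le> N\<^sup>2 * Z" by (simp add: power2_eq_square)
  then have "Z \<le> N\<^sup>2" using Z0 by (cases "Z = 0") auto
  then show "(\<Sum>k<n. (a m k)\<^sup>2) \<le> N\<^sup>2" unfolding Z_def .
  have "(\<Sum>j<n. (\<Sum>k<n. a j k * (if k = m then 1 else 0))\<^sup>2)
      \<le> N\<^sup>2 * (\<Sum>k<n. (if k = m then 1 else 0 :: real)\<^sup>2)"
    by (rule bound) auto
  then show "(\<Sum>j<n. (a j m)\<^sup>2) \<le> N\<^sup>2"
    using m by (simp add: if_distrib[of "\<lambda>c. _ * c"] if_distrib[of "\<lambda>c. c\<^sup>2"] cong: if_cong)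
qed

section \<open>From finite sections to the infinite matrix\<close>

lemma epowr_ennreal: "0 \<le> x \<Longrightarrow> epowr (ennreal x) a = ennreal (x powr a)"
  by (simp add: epowr_def)

lemma epowr_top [simp]: "epowr top a = top"
  by (simp add: epowr_def)

lemma row_norm_ennreal:
  assumes "\<And>n. (\<Sum>k<n. (cmod (b k))\<^sup>2) \<le> C"
  shows "summable (\<lambda>k. (cmod (b k))\<^sup>2)"
    and "epowr (\<Sum>k. ennreal ((cmod (b k))\<^sup>2)) s = ennreal ((\<Sum>k. (cmod (b k))\<^sup>2) powr s)"
proof -
  show s: "summable (\<lambda>k. (cmod (b k))\<^sup>2)"
    using assms by (intro summableI_nonneg_bounded[of _ C]) auto
  show "epowr (\<Sum>k. ennreal ((cmod (b k))\<^sup>2)) s = ennreal ((\<Sum>k. (cmod (b k))\<^sup>2) powr s)"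
    using s by (simp add: suminf_ennreal2 epowr_ennreal suminf_nonneg)
qed

text \<open>
  Square sections suffice: the bound on a section that contains row \<open>j\<close> controls the partial sums of
  that row, so every row is square summable and one can let the number of columns tend to infinity
  before the number of rows.
\<close>

lemma mixed_norm_le:
  assumes s: "0 < s" and N: "0 \<le> N"
    and bound: "\<And>n. (\<Sum>j<n. (\<Sum>k<n. (cmod (b j k))\<^sup>2) powr (s / 2)) \<le> N powr s"
  shows "mixed_norm (ennreal s) b \<le> ennreal N"
proof -
  have fin: "(\<Sum>k<n. (cmod (b j k))\<^sup>2) \<le> N\<^sup>2" for j n
  proof -
    define m where "m = max n (Suc j)"
    have "(\<Sum>k<m. (cmod (b j k))\<^sup>2) powr (s / 2)
        \<le> (\<Sum>j<m. (\<Sum>k<m. (cmod (b j k))\<^sup>2) powr (s / 2))"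
      by (intro member_le_sum[of j _ "\<lambda>j. (\<Sum>k<m. (cmod (b j k))\<^sup>2) powr (s / 2)"])
        (auto simp: m_def)
    also have "\<dots> \<le> N powr s" by (rule bound)
    finally have "((\<Sum>k<m. (cmod (b j k))\<^sup>2) powr (s / 2)) powr (2 / s) \<le> (N powr s) powr (2 / s)"
      using s by (intro powr_mono2) auto
    then have "(\<Sum>k<m. (cmod (b j k))\<^sup>2) \<le> N\<^sup>2"
      using s N by (simp add: powr_powr sum_nonneg)
    moreover have "(\<Sum>k<n. (cmod (b j k))\<^sup>2) \<le> (\<Sum>k<m. (cmod (b j k))\<^sup>2)"
      by (intro sum_mono2) (auto simp: m_def)
    ultimately show ?thesis by simp
  qed
  note row = row_norm_ennreal[OF fin]
  define R where "R j = (\<Sum>k. (cmod (b j k))\<^sup>2) powr (s / 2)" for j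
  have R0: "0 \<le> R j" for j unfolding R_def by simp
  have R_le: "sum R {..<m} \<le> N powr s" for m
  proof (rule tendsto_upperbound)
    show "(\<lambda>n. \<Sum>j<m. (\<Sum>k<n. (cmod (b j k))\<^sup>2) powr (s / 2)) \<longlonglongrightarrow> sum R {..<m}"
      unfolding R_def
      by (intro tendsto_sum tendsto_powr' summable_LIMSEQ row tendsto_const)
        (use s in \<open>auto intro!: always_eventually sum_nonneg\<close>)
    show "eventually (\<lambda>n. (\<Sum>j<m. (\<Sum>k<n. (cmod (b j k))\<^sup>2) powr (s / 2)) \<le> N powr s) sequentially"
    proof (rule eventually_sequentiallyI[of m])
      fix n assume "m \<le> n"
      then have "(\<Sum>j<m. (\<Sum>k<n. (cmod (b j k))\<^sup>2) powr (s / 2))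
          \<le> (\<Sum>j<n. (\<Sum>k<n. (cmod (b j k))\<^sup>2) powr (s / 2))"
        by (intro sum_mono2) auto
      then show "(\<Sum>j<m. (\<Sum>k<n. (cmod (b j k))\<^sup>2) powr (s / 2)) \<le> N powr s"
        using bound[of n] by simp
    qed
  qed simp
  have sumR: "summable R"
    using R_le R0 by (intro summableI_nonneg_bounded[of _ "N powr s"]) auto
  have "mixed_norm (ennreal s) b = epowr (\<Sum>j. ennreal (R j)) (1 / s)"
    using s unfolding mixed_norm_def R_def by (simp add: row)
  also have "\<dots> = ennreal (suminf R powr (1 / s))"
    using sumR R0 by (simp add: suminf_ennreal2 epowr_ennreal suminf_nonneg)
  also have "\<dots> \<le> ennreal ((N powr s) powr (1 / s))"
    using s R_le R0 by (intro ennreal_leI powr_mono2 suminf_le_const sumR suminf_nonneg) auto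
  also have "\<dots> = ennreal N" using s N by (simp add: powr_powr)
  finally show ?thesis .
qed

lemma mixed_norm_infinity_le:
  assumes N: "0 \<le> N"
    and bound: "\<And>n j. j < n \<Longrightarrow> (\<Sum>k<n. (cmod (b j k))\<^sup>2) \<le> N\<^sup>2"
  shows "mixed_norm \<infinity> b \<le> ennreal N"
proof -
  have fin: "(\<Sum>k<n. (cmod (b j k))\<^sup>2) \<le> N\<^sup>2" for j n
  proof -
    have "(\<Sum>k<n. (cmod (b j k))\<^sup>2) \<le> (\<Sum>k<max n (Suc j). (cmod (b j k))\<^sup>2)"
      by (intro sum_mono2) auto
    also have "\<dots> \<le> N\<^sup>2" by (rule bound) simp
    finally show ?thesis .
  qed
  note row = row_norm_ennreal[OF fin]
  show ?thesis
    unfolding mixed_norm_def if_P[OF refl]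
  proof (rule SUP_least)
    fix j
    have "(\<Sum>k. (cmod (b j k))\<^sup>2) powr (1 / 2) \<le> (N\<^sup>2) powr (1 / 2)"
      by (intro powr_mono2 suminf_le_const suminf_nonneg row(1) fin) auto
    also have "(N\<^sup>2) powr (1 / 2) = N" using N by (simp add: powr_half_sqrt)
    finally show "epowr (\<Sum>k. ennreal ((cmod (b j k))\<^sup>2)) (1 / 2) \<le> ennreal N"
      unfolding row(2) by (rule ennreal_leI)
  qed
qed

section \<open>Testing the operator on finitely supported vectors\<close>

lemma lp_norm_finite_support:
  assumes P: "0 < P" and x: "\<And>k. n \<le> k \<Longrightarrow> x k = 0"
  shows "lp_norm (ennreal P) x = ennreal ((\<Sum>k<n. cmod (x k) powr P) powr (1 / P))"
proof -
  have "(\<Sum>k. ennreal (cmod (x k) powr P)) = (\<Sum>k<n. ennreal (cmod (x k) powr P))"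
    by (rule suminf_finite) (auto simp: x not_less)
  also have "\<dots> = ennreal (\<Sum>k<n. cmod (x k) powr P)" by (rule sum_ennreal) simp
  finally show ?thesis
    using P by (simp add: lp_norm_def epowr_ennreal sum_nonneg)
qed

lemma finite_support_in_lp_space:
  assumes p: "0 < p" and x: "\<And>k. n \<le> k \<Longrightarrow> x k = 0"
  shows "x \<in> lp_space p"
proof (cases p)
  case (real P)
  then show ?thesis using p lp_norm_finite_support[of P n x] x by (simp add: lp_space_def)
next
  case top
  have "x \<longlonglongrightarrow> 0"
    by (rule tendsto_eventually, rule eventually_sequentiallyI[of n]) (use x in auto)
  then show ?thesis using top by (simp add: lp_space_def)
qed

lemma operator_finite_support:
  assumes A: "bounded_linear_operator p q A" and p: "0 < p"
    and x: "\<And>k. n \<le> k \<Longrightarrow> x k = 0"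
  shows "A x j = (\<Sum>k<n. x k * matrix_entry A j k)"
proof -
  define trunc where "trunc m = (\<lambda>k. if k < m then x k else 0)" for m
  note lin = A[unfolded bounded_linear_operator_def]
  have mem: "trunc m \<in> lp_space p" for m
    using p by (rule finite_support_in_lp_space[of _ m]) (auto simp: trunc_def)
  have unit: "unit_seq m \<in> lp_space p" for m
    using p by (rule finite_support_in_lp_space[of _ "Suc m"]) (auto simp: unit_seq_def)
  have unit': "(\<lambda>k. c * unit_seq m k) \<in> lp_space p" for m c
    using p by (rule finite_support_in_lp_space[of _ "Suc m"]) (auto simp: unit_seq_def)
  have "A (trunc m) j = (\<Sum>k<m. x k * matrix_entry A j k)" for m
  proof (induction m)
    case 0
    have "A (\<lambda>k. 0 * trunc 0 k) = (\<lambda>j. 0 * A (trunc 0) j)" using lin mem by blast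
    then have "A (trunc 0) = (\<lambda>j. 0)" by (simp add: trunc_def)
    then show ?case by simp
  next
    case (Suc m)
    have "trunc (Suc m) = (\<lambda>k. trunc m k + x m * unit_seq m k)"
      by (auto simp: trunc_def unit_seq_def fun_eq_iff less_Suc_eq)
    then have "A (trunc (Suc m)) = (\<lambda>j. A (trunc m) j + A (\<lambda>k. x m * unit_seq m k) j)"
      using lin mem unit' by auto
    moreover have "A (\<lambda>k. x m * unit_seq m k) = (\<lambda>j. x m * A (unit_seq m) j)"
      using lin unit by blast
    ultimately show ?case using Suc by (simp add: matrix_entry_def)
  qed
  moreover have "trunc n = x" using x by (auto simp: trunc_def fun_eq_iff not_less)
  ultimately show ?thesis by metis
qed

lemma operator_norm_finite:
  assumes "bounded_linear_operator p q A"
  shows "operator_norm p q A < \<infinity>"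
proof -
  obtain C :: real where C: "\<And>x. x \<in> lp_space p \<Longrightarrow> lp_norm q (A x) \<le> ennreal C * lp_norm p x"
    using assms unfolding bounded_linear_operator_def by blast
  have "operator_norm p q A \<le> ennreal C"
    unfolding operator_norm_def
  proof (rule SUP_least)
    fix x assume x: "x \<in> {x \<in> lp_space p. lp_norm p x \<le> 1}"
    then have "lp_norm q (A x) \<le> ennreal C * lp_norm p x" using C by simp
    also have "\<dots> \<le> ennreal C * 1" using x by (intro mult_left_mono) auto
    finally show "lp_norm q (A x) \<le> ennreal C" by simp
  qed
  then show ?thesis using ennreal_less_top le_less_trans infinity_ennreal_def by metis
qed

lemma sum_powr_le_of_lp_norm_le:
  assumes Q: "0 < Q" and N: "0 \<le> N" and z: "lp_norm (ennreal Q) z \<le> ennreal N"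
  shows "(\<Sum>j<n. cmod (z j) powr Q) \<le> N powr Q"
proof -
  let ?S = "\<Sum>j. ennreal (cmod (z j) powr Q)"
  have le: "epowr ?S (1 / Q) \<le> ennreal N"
    using z Q by (simp add: lp_norm_def epowr_ennreal)
  show ?thesis
  proof (cases ?S)
    case (real S)
    then have "S powr (1 / Q) \<le> N"
      using le N by (simp add: epowr_ennreal)
    then have "(S powr (1 / Q)) powr Q \<le> N powr Q" using Q by (intro powr_mono2) auto
    then have "S \<le> N powr Q" using Q real by (simp add: powr_powr)
    moreover have "ennreal (\<Sum>j<n. cmod (z j) powr Q) \<le> ennreal S"
    proof -
      have "(\<Sum>j<n. ennreal (cmod (z j) powr Q)) \<le> ?S" by (rule sum_le_suminf) auto
      then show ?thesis using real by simp
    qed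
    ultimately show ?thesis using real by (simp add: ennreal_le_iff)
  next
    case top
    then show ?thesis using le by (simp add: top_unique)
  qed
qed

lemma section_bound:
  assumes A: "bounded_linear_operator p (ennreal Q) A" and p: "0 < p" and Q: "0 < Q"
    and N: "operator_norm p (ennreal Q) A = ennreal N" "0 \<le> N"
    and a: "\<And>j k. matrix_entry A j k = complex_of_real (a j k)"
    and x: "\<And>k. n \<le> k \<Longrightarrow> x k = 0" and x1: "lp_norm p (\<lambda>k. complex_of_real (x k)) \<le> 1"
  shows "(\<Sum>j<n. \<bar>\<Sum>k<n. a j k * x k\<bar> powr Q) \<le> N powr Q"
proof -
  let ?x = "\<lambda>k. complex_of_real (x k)"
  have "?x \<in> lp_space p" using p by (rule finite_support_in_lp_space[of _ n]) (simp add: x)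
  then have "lp_norm (ennreal Q) (A ?x) \<le> operator_norm p (ennreal Q) A"
    unfolding operator_norm_def using x1 by (intro SUP_upper) auto
  then have "(\<Sum>j<n. cmod (A ?x j) powr Q) \<le> N powr Q"
    using Q N by (intro sum_powr_le_of_lp_norm_le) auto
  moreover have "A ?x j = complex_of_real (\<Sum>k<n. a j k * x k)" for j
    using operator_finite_support[OF A p, of n ?x j] x by (simp add: a mult.commute)
  ultimately show ?thesis by (simp only: norm_of_real)
qed

text \<open>
  By homogeneity this is the case of a unit vector; the zero vector, which cannot be normalized, is
  treated separately.
\<close>

lemma section_bound_lp:
  assumes A: "bounded_linear_operator (ennreal P) (ennreal Q) A" and P: "0 < P" and Q: "0 < Q"
    and N: "operator_norm (ennreal P) (ennreal Q) A = ennreal N" "0 \<le> N"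
    and a: "\<And>j k. matrix_entry A j k = complex_of_real (a j k)" "\<And>j k. 0 \<le> a j k"
    and x: "\<And>k. 0 \<le> x k"
  shows "(\<Sum>j<n. (\<Sum>k<n. a j k * x k) powr Q) \<le> N powr Q * (\<Sum>k<n. x k powr P) powr (Q / P)"
proof -
  define s where "s = (\<Sum>k<n. x k powr P) powr (1 / P)"
  have sP: "s powr P = (\<Sum>k<n. x k powr P)"
    unfolding s_def using P by (simp add: powr_powr sum_nonneg)
  show ?thesis
  proof (cases "s = 0")
    case True
    then have "(\<Sum>k<n. x k powr P) = 0" using sP P by simp
    then have "x k = 0" if "k < n" for k
      using that by (subst (asm) sum_nonneg_eq_0_iff) auto
    then show ?thesis using Q by simp
  next
    case False
    then have s: "0 < s" unfolding s_def by simp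
    define z where "z k = (if k < n then x k / s else 0)" for k
    have "(\<Sum>k<n. z k powr P) = (\<Sum>k<n. x k powr P) / s powr P"
      using s x by (simp add: z_def powr_divide sum_divide_distrib)
    also have "\<dots> = 1" unfolding sP[symmetric] using s by simp
    finally have "(\<Sum>k<n. cmod (complex_of_real (z k)) powr P) = 1"
      using s x by (simp add: z_def norm_divide)
    then have "lp_norm (ennreal P) (\<lambda>k. complex_of_real (z k)) \<le> 1"
      using lp_norm_finite_support[OF P, of n "\<lambda>k. complex_of_real (z k)"]
      by (simp add: z_def)
    then have "(\<Sum>j<n. \<bar>\<Sum>k<n. a j k * z k\<bar> powr Q) \<le> N powr Q"
      using P by (intro section_bound[OF A _ Q N a(1)]) (auto simp: z_def)
    moreover have "\<bar>\<Sum>k<n. a j k * z k\<bar> powr Q = (\<Sum>k<n. a j k * x k) powr Q / s powr Q" for j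
    proof -
      have "(\<Sum>k<n. a j k * z k) = (\<Sum>k<n. a j k * x k) / s"
        by (simp add: z_def sum_divide_distrib)
      then show ?thesis using s a x by (simp add: powr_divide sum_nonneg)
    qed
    ultimately have "(\<Sum>j<n. (\<Sum>k<n. a j k * x k) powr Q) / s powr Q \<le> N powr Q"
      by (simp add: sum_divide_distrib)
    then have "(\<Sum>j<n. (\<Sum>k<n. a j k * x k) powr Q) \<le> N powr Q * s powr Q"
      using s by (simp add: field_simps)
    also have "s powr Q = (\<Sum>k<n. x k powr P) powr (Q / P)"
      unfolding s_def by (simp add: powr_powr)
    finally show ?thesis .
  qed
qed

section \<open>The theorem\<close>

theorem mainTheorem1:
  fixes p q r :: ennreal
  assumes "1 \<le> q" and "q \<le> 2" and "2 \<le> p" and "p \<le> \<infinity>"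
    and "1 / r = 1 / q - 1 / p"
  shows "\<exists>M::real. M > 0 \<and>
    (\<forall>A. bounded_linear_operator p q A \<longrightarrow>
         (\<forall>j k. matrix_entry A j k \<in> \<real>\<^sub>\<ge>\<^sub>0) \<longrightarrow>
         mixed_norm r (\<lambda>j k. matrix_entry A j k) \<le> ennreal M * operator_norm p q A \<and>
         mixed_norm r (\<lambda>k j. matrix_entry A j k) \<le> ennreal M * operator_norm p q A)"
proof (rule exI[of _ 1], intro conjI allI impI)
  show "(0::real) < 1" by simp
next
  fix A
  assume A: "bounded_linear_operator p q A" and nonneg: "\<forall>j k. matrix_entry A j k \<in> \<real>\<^sub>\<ge>\<^sub>0"
  have "q < top" using \<open>q \<le> 2\<close> by (rule le_less_trans) simp
  then obtain Q where q: "q = ennreal Q" "0 \<le> Q" by (cases q) auto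
  have Q: "1 \<le> Q" "Q \<le> 2"
    using assms(1,2) q by (auto simp: ennreal_le_iff simp flip: ennreal_1 ennreal_numeral)
  define N where "N = enn2real (operator_norm p q A)"
  have N: "operator_norm p q A = ennreal N" "0 \<le> N"
    unfolding N_def using operator_norm_finite[OF A] by auto
  define a where "a j k = Re (matrix_entry A j k)" for j k
  have a: "matrix_entry A j k = complex_of_real (a j k)" "0 \<le> a j k" for j k
    using nonneg[rule_format, of j k] unfolding a_def complex_nonneg_Reals_iff
    by (auto simp: complex_eq_iff)
  have norm_a: "cmod (matrix_entry A j k) = a j k" for j k
    using a[of j k] by simp
  have r_eq: "r = 1 / (1 / q - 1 / p)"
    using assms(5) one_divide_one_divide_ennreal[of r] by simp
  have "mixed_norm r (\<lambda>j k. matrix_entry A j k) \<le> ennreal N \<and>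
      mixed_norm r (\<lambda>k j. matrix_entry A j k) \<le> ennreal N"
  proof (cases p)
    case (real P)
    then have P: "2 \<le> P" using assms(3) by (auto simp: ennreal_le_iff simp flip: ennreal_numeral)
    have bound: "(\<Sum>j<n. (\<Sum>k<n. a j k * x k) powr Q) \<le> N powr Q * (\<Sum>k<n. x k powr P) powr (Q / P)"
      if "\<And>k. 0 \<le> x k" for n x
      using section_bound_lp[where P = P and Q = Q and A = A and N = N and a = a and x = x and n = n] A N a P Q real q that by simp
    have diff: "1 / q - 1 / p = ennreal (1 / Q - 1 / P)"
      using real q P Q by (simp add: divide_ennreal ennreal_minus flip: ennreal_1)
    show ?thesis
    proof (cases "Q < P")
      case True
      define R where "R = P * Q / (P - Q)"
      have R0: "0 < R" unfolding R_def using True P Q by simp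
      have "1 / Q - 1 / P = 1 / R" unfolding R_def using True P Q by (simp add: field_simps)
      then have r: "r = ennreal R"
        using r_eq diff R0 by (simp add: divide_ennreal flip: ennreal_1)
      show ?thesis
        unfolding r
      proof (intro conjI mixed_norm_le R0 N(2))
        fix n
        note fin = finite_section_bounds[where a = a and n = n, OF a(2) Q P True N(2) R_def bound]
        show "(\<Sum>j<n. (\<Sum>k<n. (cmod (matrix_entry A j k))\<^sup>2) powr (R / 2)) \<le> N powr R"
          unfolding norm_a by (rule fin(1))
        show "(\<Sum>k<n. (\<Sum>j<n. (cmod (matrix_entry A j k))\<^sup>2) powr (R / 2)) \<le> N powr R"
          unfolding norm_a by (rule fin(2))
      qed
    next
      case False
      then have PQ: "P = 2" "Q = 2" using P Q by auto
      have r: "r = \<infinity>" using r_eq diff PQ by simp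
      have bound2: "(\<Sum>j<n. (\<Sum>k<n. a j k * x k)\<^sup>2) \<le> N\<^sup>2 * (\<Sum>k<n. (x k)\<^sup>2)"
        if "\<And>k. 0 \<le> x k" for n x
      proof -
        have pos: "0 \<le> (\<Sum>k<n. a j k * x k)" for j
          by (intro sum_nonneg mult_nonneg_nonneg a that)
        have sq: "u powr 2 = u\<^sup>2" if "0 \<le> u" for u :: real
          using that by simp
        have "(\<Sum>k<n. x k powr 2) powr (2 / 2) = (\<Sum>k<n. (x k)\<^sup>2)"
          by (simp add: sq[OF that] sum_nonneg)
        then show ?thesis
          using bound[where n = n and x = x, OF that] unfolding PQ by (simp only: sq[OF pos] sq[OF N(2)])
      qed
      show ?thesis
        unfolding r
      proof (intro conjI mixed_norm_infinity_le N(2))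
        fix n m :: nat
        assume m: "m < n"
        note fin = finite_section_bounds_l2[where a = a and n = n and m = m, OF a(2) bound2 m]
        show "(\<Sum>k<n. (cmod (matrix_entry A m k))\<^sup>2) \<le> N\<^sup>2"
          unfolding norm_a by (rule fin(1))
        show "(\<Sum>j<n. (cmod (matrix_entry A j m))\<^sup>2) \<le> N\<^sup>2"
          unfolding norm_a by (rule fin(2))
      qed
    qed
  next
    case top
    have r: "r = ennreal Q" using r_eq top q by simp
    have bound: "(\<Sum>j<n. (\<Sum>k<n. a j k) powr Q) \<le> N powr Q" for n
    proof -
      define x where "x k = (if k < n then 1 else 0 :: real)" for k
      have "lp_norm p (\<lambda>k. complex_of_real (x k)) \<le> 1"
        unfolding top lp_norm_def by (auto simp: x_def SUP_le_iff)
      then have "(\<Sum>j<n. \<bar>\<Sum>k<n. a j k * x k\<bar> powr Q) \<le> N powr Q"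
        using A Q N a top q by (intro section_bound[where p = p and A = A and n = n]) (auto simp: x_def)
      then show ?thesis using a(2) by (simp add: x_def sum_nonneg)
    qed
    have Q0: "0 < Q" using Q by simp
    show ?thesis
      unfolding r
    proof (intro conjI mixed_norm_le Q0 N(2))
      fix n
      note fin = finite_section_bounds_c0[where a = a and n = n, OF a(2) Q bound]
      show "(\<Sum>j<n. (\<Sum>k<n. (cmod (matrix_entry A j k))\<^sup>2) powr (Q / 2)) \<le> N powr Q"
        unfolding norm_a by (rule fin(1))
      show "(\<Sum>k<n. (\<Sum>j<n. (cmod (matrix_entry A j k))\<^sup>2) powr (Q / 2)) \<le> N powr Q"
        unfolding norm_a by (rule fin(2))
    qed
  qed
  then show "mixed_norm r (\<lambda>j k. matrix_entry A j k) \<le> ennreal 1 * operator_norm p q A"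
    and "mixed_norm r (\<lambda>k j. matrix_entry A j k) \<le> ennreal 1 * operator_norm p q A"
    using N by simp_all
qed

end
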